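(* Let $A$ be an abelian group of order $n$. Then the number of subsets $S\subseteq A$ such that $\mathrm{Cay}(A,S)$ is not a DRR is at most $2^{3n/4+2(\log_2 n)^2+1}$.
   Context: All groups and digraphs are finite. A digraph is a pair $(V,R)$ with $V$ finite nonempty and $R\subseteq V\times V$ (loops allowed). For a group $G$ and $S\subseteq G$, the Cayley digraph $\mathrm{Cay}(G,S)$ has vertex set $G$, with $(g,h)$ an arc iff $gh^{-1}\in S$. $G$ acts regularly on it by right multiplication, and $\mathrm{Cay}(G,S)$ is a DRR if its full automorphism group equals this right regular action of $G$. *)

theory Defs
  imports Complex_Main "HOL-Algebra.Group"
begin

text \<open>A digraph is a pair (V, R) with R a subset of V x V. Its automorphisms are
  the bijections of V preserving arcs in both directions; we normalise them to be
  extensional on V so that the automorphism group is a set of functions.\<close>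
definition digraph_aut :: "'a set \<Rightarrow> ('a \<times> 'a) set \<Rightarrow> ('a \<Rightarrow> 'a) set" where
  "digraph_aut V R = {f. f \<in> extensional V \<and> bij_betw f V V \<and>
      (\<forall>x\<in>V. \<forall>y\<in>V. (x, y) \<in> R \<longleftrightarrow> (f x, f y) \<in> R)}"

definition cayley_arcs :: "('a, 'b) monoid_scheme \<Rightarrow> 'a set \<Rightarrow> ('a \<times> 'a) set" where
  "cayley_arcs G S = {(g, h). g \<in> carrier G \<and> h \<in> carrier G \<and> g \<otimes>\<^bsub>G\<^esub> inv\<^bsub>G\<^esub> h \<in> S}"

definition right_regular :: "('a, 'b) monoid_scheme \<Rightarrow> ('a \<Rightarrow> 'a) set" where
  "right_regular G = {(\<lambda>x\<in>carrier G. x \<otimes>\<^bsub>G\<^esub> g) | g. g \<in> carrier G}"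

definition is_DRR :: "('a, 'b) monoid_scheme \<Rightarrow> 'a set \<Rightarrow> bool" where
  "is_DRR G S \<longleftrightarrow> digraph_aut (carrier G) (cayley_arcs G S) = right_regular G"

end

(* Let U be a minimal composition-closed set of automorphisms of Cay(A, S) that strictly contains
   the regular copy of A.  If some element of U outside A normalises A, then a nontrivial group
   automorphism of A preserves S.  Otherwise A is self-normalising and maximal in U, and for g
   outside A the intersection of A with its g-conjugate is the centre Z of U (as in a Frobenius
   complement modulo Z).  The transfer x |-> prod_{t in U_1} t(x), with U_1 the stabiliser of 1, is
   constant on U_1-orbits and maps x into xZ; so every t in U_1 acts on each coset aZ by a
   translation zeta_t(a) in Z.  The commutator s |-> [s, b] is a bijection of U_1 for b outside Z, and
   zeta_[s,b](a) is symmetric in a and b, so the translations zeta_t(a), t in U_1, are the same for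
   all a outside Z.  Hence S \ Z is invariant under multiplication by a nontrivial element of Z.

   In both cases S is invariant under a permutation fixing at most half of A, which happens for
   at most 2^(3n/4) sets S.  As subgroups need at most log2 n generators, there are at most
   (1 + n) n^(log2 n) such permutations. *)
theory Submission
  imports Defs "HOL-Algebra.Generated_Groups" "HOL-Algebra.FiniteProduct" "HOL-Combinatorics.Permutations"
begin

section \<open>Counting invariant subsets, subgroups and automorphisms\<close>

text \<open>An invariant set is determined by its intersection with any set meeting all orbits. An
  orbit of moved points has at least two elements, so the fixed points and at most half of the moved
  points suffice, which is at most 3/4 of \<open>V\<close>.\<close>

lemma card_invariant_subsets_le:
  fixes p :: "'a \<Rightarrow> 'a"
  assumes "finite V" and p: "p permutes V" and few_fixed: "2 * card {x\<in>V. p x = x} \<le> card V"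
  shows "real (card {S. S \<subseteq> V \<and> (\<forall>x\<in>V. x \<in> S \<longleftrightarrow> p x \<in> S)}) \<le> 2 powr (3 * real (card V) / 4)"
proof -
  \<comment> \<open>If \<open>R\<close> is a smallest set meeting all orbits, then \<open>p\<close> maps its non-fixed points out of \<open>R\<close>.\<close>
  define hits where "hits R \<longleftrightarrow> R \<subseteq> V \<and> (\<forall>x\<in>V. \<exists>i. (p ^^ i) x \<in> R)" for R
  have "hits V"
    by (auto simp: hits_def intro!: exI[of _ 0])
  then obtain R where R: "hits R" and min: "\<And>Q. hits Q \<Longrightarrow> card R \<le> card Q"
    using ex_has_least_nat[of hits V card] by blast
  have "R \<subseteq> V" and fR: "finite R"
    using R \<open>finite V\<close> by (auto simp: hits_def intro: finite_subset)
  have pV: "p x \<in> V" if "x \<in> V" for x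
    using p that by (simp add: permutes_in_image)
  let ?F = "{x\<in>V. p x = x}"
  have out: "p x \<notin> R" if x: "x \<in> R" "p x \<noteq> x" for x
  proof
    assume "p x \<in> R"
    have "hits (R - {x})"
      unfolding hits_def
    proof (intro conjI ballI)
      fix y assume "y \<in> V"
      then obtain i where i: "(p ^^ i) y \<in> R"
        using R by (auto simp: hits_def)
      show "\<exists>i. (p ^^ i) y \<in> R - {x}"
      proof (cases "(p ^^ i) y = x")
        case True
        then show ?thesis
          using \<open>p x \<in> R\<close> x by (intro exI[of _ "Suc i"]) simp
      next
        case False
        then show ?thesis using i by blast
      qed
    qed (use \<open>R \<subseteq> V\<close> in auto)
    then have "card R \<le> card (R - {x})" by (rule min)
    then show False using x fR
      by (metis card_Diff1_less linorder_not_less)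
  qed
  have "card (R - ?F) \<le> card (V - R)"
  proof (rule card_inj_on_le[of p])
    show "inj_on p (R - ?F)"
      using permutes_inj[OF p] by (rule inj_on_subset) simp
    show "p ` (R - ?F) \<subseteq> V - R"
      using \<open>R \<subseteq> V\<close> out pV by blast
  qed (use \<open>finite V\<close> in simp)
  moreover have "card R \<le> card (R - ?F) + card ?F"
  proof -
    have "card R \<le> card ((R - ?F) \<union> ?F)"
      using fR \<open>finite V\<close> by (intro card_mono) auto
    also have "\<dots> \<le> card (R - ?F) + card ?F"
      by (rule card_Un_le)
    finally show ?thesis .
  qed
  moreover have "card (V - R) = card V - card R" "card R \<le> card V"
    using \<open>R \<subseteq> V\<close> \<open>finite V\<close> by (auto simp: card_Diff_subset fR card_mono)
  ultimately have R34: "4 * card R \<le> 3 * card V"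
    using few_fixed by linarith
  let ?I = "{S. S \<subseteq> V \<and> (\<forall>x\<in>V. x \<in> S \<longleftrightarrow> p x \<in> S)}"
  have iter: "x \<in> S \<longleftrightarrow> (p ^^ i) x \<in> S" if "S \<in> ?I" "x \<in> V" for S x i
  proof (induction i)
    case (Suc i)
    have "(p ^^ i) x \<in> V"
      using that(2) by (induction i) (auto simp: pV)
    then show ?case using Suc that by auto
  qed simp
  have "inj_on (\<lambda>S. S \<inter> R) ?I"
  proof (rule inj_onI)
    fix S S' assume S: "S \<in> ?I" "S' \<in> ?I" and eq: "S \<inter> R = S' \<inter> R"
    have "x \<in> S \<longleftrightarrow> x \<in> S'" for x
    proof (cases "x \<in> V")
      case True
      then obtain i where "(p ^^ i) x \<in> R"
        using R by (auto simp: hits_def)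
      then show ?thesis
        using iter[OF S(1) True, of i] iter[OF S(2) True, of i] eq by blast
    next
      case False
      then show ?thesis using S by blast
    qed
    then show "S = S'" by blast
  qed
  then have "card ?I \<le> card (Pow R)"
    by (rule card_inj_on_le) (use fR in auto)
  then have "real (card ?I) \<le> 2 ^ card R"
    using fR by (simp add: card_Pow flip: of_nat_le_iff)
  also have "\<dots> = 2 powr real (card R)"
    by (simp add: powr_realpow)
  also have "\<dots> \<le> 2 powr (3 * real (card V) / 4)"
    using R34 by (intro powr_mono) (simp_all add: field_simps flip: of_nat_le_iff)
  finally show ?thesis .
qed

section \<open>Few generators, hence few subgroups and automorphisms\<close>

context group
begin

lemma card_proper_subgroup_le:
  assumes H: "subgroup H G" and K: "subgroup K G" and sub: "H \<subset> K" and fin: "finite K"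
  shows "2 * card H \<le> card K"
proof -
  obtain x where x: "x \<in> K" "x \<notin> H" using sub by blast
  have Kc: "K \<subseteq> carrier G" and Hc: "H \<subseteq> carrier G"
    using H K by (simp_all add: subgroup.subset)
  have "card H \<le> card (K - H)"
  proof (rule card_inj_on_le[of "\<lambda>h. h \<otimes> x"])
    show "inj_on (\<lambda>h. h \<otimes> x) H"
      using x Kc Hc by (intro inj_onI) (auto simp: subset_iff)
    have "h \<otimes> x \<in> K - H" if "h \<in> H" for h
    proof
      show "h \<otimes> x \<in> K"
        using that x sub K by (auto intro: subgroup.m_closed)
      show "h \<otimes> x \<notin> H"
      proof
        assume "h \<otimes> x \<in> H"
        then have "inv h \<otimes> (h \<otimes> x) \<in> H"
          using that H by (simp add: subgroup.m_closed subgroup.m_inv_closed)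
        then show False
          using that x Hc Kc by (simp add: subset_iff flip: m_assoc)
      qed
    qed
    then show "(\<lambda>h. h \<otimes> x) ` H \<subseteq> K - H" by blast
  qed (use fin in simp)
  moreover have "card (K - H) = card K - card H" "card H \<le> card K"
    using sub fin by (auto simp: card_Diff_subset finite_subset card_mono)
  ultimately show ?thesis by linarith
qed

text \<open>Adjoining an element outside the generated subgroup at least doubles it, by
  \<open>card_proper_subgroup_le\<close>. So a largest \<open>X\<close> with property
  \<open>P\<close> already generates \<open>K\<close>.\<close>

lemma obtain_small_generating_set:
  assumes K: "subgroup K G" and fin: "finite K"
  obtains X where "X \<subseteq> K" "generate G X = K" "2 ^ card X \<le> card K"
proof -
  define P where "P X \<longleftrightarrow> X \<subseteq> K \<and> 2 ^ card X \<le> card (generate G X)" for X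
  have Kc: "K \<subseteq> carrier G"
    using K by (rule subgroup.subset)
  have gK: "generate G X \<subseteq> K" if "X \<subseteq> K" for X
    using that K by (rule generate_subgroup_incl)
  have "P {}"
    by (simp add: P_def generate_empty)
  moreover have "\<forall>X. P X \<longrightarrow> card X < Suc (card K)"
    using fin by (auto simp: P_def card_mono less_Suc_eq_le)
  ultimately obtain X where X: "P X" and max: "\<And>Y. P Y \<Longrightarrow> card Y \<le> card X"
    using ex_has_greatest_nat[of P "{}" card] by (metis less_Suc_eq_le)
  have XK: "X \<subseteq> K" and Xf: "finite X"
    using X fin by (auto simp: P_def intro: finite_subset)
  have "generate G X = K"
  proof (rule ccontr)
    assume "generate G X \<noteq> K"
    then obtain x where x: "x \<in> K" "x \<notin> generate G X"
      using gK[OF XK] by blast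
    have "x \<notin> X"
      using x generate.incl[of x X G] by blast
    have "generate G X \<subset> generate G (insert x X)"
      using x mono_generate[of X "insert x X"] generate.incl[of x "insert x X" G] by blast
    then have "2 * card (generate G X) \<le> card (generate G (insert x X))"
      using x XK Kc fin gK[of "insert x X"]
      by (intro card_proper_subgroup_le generate_is_subgroup) (auto intro: finite_subset)
    then have "P (insert x X)"
      using X x \<open>x \<notin> X\<close> Xf by (simp add: P_def)
    then show False
      using max[of "insert x X"] \<open>x \<notin> X\<close> Xf by simp
  qed
  then show ?thesis
    using that X by (auto simp: P_def)
qed

text \<open>Padding with \<open>\<one>\<close> gives all lists the same length \<open>d\<close>, so
  that counting them yields a pure power. In the application \<open>d\<close> is the integer part of
  the binary logarithm of the group order.\<close>

lemma obtain_generating_list: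
  assumes K: "subgroup K G" and fin: "finite K" and d: "card K < 2 ^ Suc d"
  obtains xs where "set xs \<subseteq> K" "length xs = d" "generate G (set xs) = K"
proof -
  obtain X where X: "X \<subseteq> K" "generate G X = K" "2 ^ card X \<le> card K"
    using obtain_small_generating_set[OF K fin] .
  have Xf: "finite X"
    using X(1) fin by (rule finite_subset)
  then obtain ys where ys: "set ys = X" "distinct ys"
    using finite_distinct_list by blast
  have "(2::nat) ^ card X < 2 ^ Suc d"
    using X(3) d by linarith
  then have "card X < Suc d"
    by (rule power_less_imp_less_exp[rotated]) simp
  then have "length ys \<le> d"
    using ys by (simp flip: distinct_card)
  let ?xs = "ys @ replicate (d - length ys) \<one>"
  have 1: "set ?xs \<subseteq> K"
    using X(1) ys K by (auto simp: subgroup.one_closed)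
  have "X \<subseteq> set ?xs"
    using ys by simp
  then have "K \<subseteq> generate G (set ?xs)"
    using mono_generate X(2) by blast
  moreover have "generate G (set ?xs) \<subseteq> K"
    using 1 K by (rule generate_subgroup_incl)
  ultimately show ?thesis
    using that[of ?xs] 1 \<open>length ys \<le> d\<close> by simp
qed

lemma card_subgroups_le:
  assumes fin: "finite (carrier G)" and d: "card (carrier G) < 2 ^ Suc d"
  shows "card {H. subgroup H G} \<le> card (carrier G) ^ d"
proof -
  let ?L = "{xs. set xs \<subseteq> carrier G \<and> length xs = d}"
  have "{H. subgroup H G} \<subseteq> (\<lambda>xs. generate G (set xs)) ` ?L"
  proof
    fix H assume "H \<in> {H. subgroup H G}"
    then have H: "subgroup H G" by simp
    have Hc: "H \<subseteq> carrier G"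
      using H by (rule subgroup.subset)
    have "card H < 2 ^ Suc d"
      using card_mono[OF fin Hc] d by linarith
    then show "H \<in> (\<lambda>xs. generate G (set xs)) ` ?L"
      using obtain_generating_list[OF H finite_subset[OF Hc fin]] Hc
      by (smt (verit) image_iff mem_Collect_eq subset_trans)
  qed
  then have "card {H. subgroup H G} \<le> card ?L"
    by (rule surj_card_le[OF finite_lists_length_eq[OF fin]])
  then show ?thesis
    by (simp add: card_lists_length_eq fin)
qed

lemma subgroup_equalizer:
  assumes "f \<in> hom G G" "g \<in> hom G G"
  shows "subgroup {x \<in> carrier G. f x = g x} G"
proof -
  interpret f: group_hom G G f using assms by unfold_locales
  interpret g: group_hom G G g using assms by unfold_locales
  show ?thesis
    by unfold_locales auto
qed

text \<open>Automorphisms are extended by the identity, to be determined by their values on the carrier.\<close>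

definition perm_autos :: "('a \<Rightarrow> 'a) set" where
  "perm_autos = {f. f permutes carrier G \<and> f \<in> hom G G}"

text \<open>Two automorphisms agree on a subgroup, so the values at \<open>d\<close> fixed
  generators determine an automorphism.\<close>

lemma card_perm_autos_le:
  assumes fin: "finite (carrier G)" and d: "card (carrier G) < 2 ^ Suc d"
  shows "card perm_autos \<le> card (carrier G) ^ d"
proof -
  let ?L = "{xs. set xs \<subseteq> carrier G \<and> length xs = d}"
  obtain xs where xs: "set xs \<subseteq> carrier G" "length xs = d" "generate G (set xs) = carrier G"
    using obtain_generating_list[OF subgroup_self fin d] .
  have "inj_on (\<lambda>f. map f xs) perm_autos"
  proof (rule inj_onI)
    fix f g assume f: "f \<in> perm_autos" and g: "g \<in> perm_autos" and "map f xs = map g xs"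
    then have "set xs \<subseteq> {x \<in> carrier G. f x = g x}"
      using xs by auto
    then have in_eq: "carrier G \<subseteq> {x \<in> carrier G. f x = g x}"
      using generate_subgroup_incl[OF _ subgroup_equalizer[of f g], of "set xs"] f g xs(3)
      unfolding perm_autos_def mem_Collect_eq by metis
    have "f permutes carrier G" "g permutes carrier G"
      using f g by (simp_all add: perm_autos_def)
    then have "f x = g x" if "x \<notin> carrier G" for x
      using that by (simp add: permutes_not_in)
    moreover have "f x = g x" if "x \<in> carrier G" for x
      using in_eq that by blast
    ultimately show "f = g"
      by blast
  qed
  moreover have "(\<lambda>f. map f xs) ` perm_autos \<subseteq> ?L"
    using xs by (auto simp: perm_autos_def permutes_in_image subset_iff)
  ultimately have "card perm_autos \<le> card ?L"
    using finite_lists_length_eq[OF fin] by (rule card_inj_on_le)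
  then show ?thesis
    by (simp add: card_lists_length_eq fin)
qed

end

section \<open>Overgroups of a regular abelian group\<close>

text \<open>Being the identity off the carrier makes a shift a permutation in the sense of
  \<open>permutes\<close>, with ordinary composition as the group operation.\<close>

definition (in monoid) shift :: "'a \<Rightarrow> 'a \<Rightarrow> 'a" where
  "shift a = (\<lambda>x. if x \<in> carrier G then x \<otimes> a else x)"

definition (in monoid) shifts :: "('a \<Rightarrow> 'a) set" where
  "shifts = shift ` carrier G"

lemma (in monoid) shift_apply [simp]: "x \<in> carrier G \<Longrightarrow> shift a x = x \<otimes> a"
  by (simp add: shift_def)

lemma (in group) eq_mult_inv:
  "a \<otimes> c = b \<Longrightarrow> a \<in> carrier G \<Longrightarrow> c \<in> carrier G \<Longrightarrow> a = b \<otimes> inv c"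
  by (auto simp: m_assoc)

lemma (in group) mult_eq_one_if_absorbed:
  assumes "p = a \<otimes> (b \<otimes> p)" "a \<in> carrier G" "b \<in> carrier G" "p \<in> carrier G"
  shows "a \<otimes> b = \<one>"
proof -
  have "a \<otimes> b \<otimes> p = \<one> \<otimes> p"
    using assms(1)[symmetric] assms(2-4) by (simp add: m_assoc)
  then show ?thesis
    using assms(2-4) by simp
qed

lemma (in group) shift_permutes: "a \<in> carrier G \<Longrightarrow> shift a permutes carrier G"
proof (rule bij_imp_permutes)
  assume a: "a \<in> carrier G"
  show "bij_betw (shift a) (carrier G) (carrier G)"
    by (rule bij_betw_byWitness[of _ "shift (inv a)"]) (use a in \<open>auto simp: shift_def m_assoc\<close>)
qed (simp add: shift_def)

lemma (in comm_group) finprod_in_subgroup: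
  assumes "subgroup H G" "\<And>i. i \<in> I \<Longrightarrow> f i \<in> H"
  shows "finprod G f I \<in> H"
proof (cases "finite I")
  case True
  then show ?thesis using assms(2)
  proof (induction I)
    case (insert i I)
    then have "f \<in> I \<rightarrow> carrier G" "f i \<in> carrier G"
      using subgroup.subset[OF assms(1)] by auto
    then show ?case
      using insert assms(1) by (simp add: subgroup.m_closed)
  qed (simp add: subgroup.one_closed assms(1))
qed (simp add: subgroup.one_closed assms(1))

locale regular_overgroup = comm_group G for G (structure) +
  fixes U :: "('a \<Rightarrow> 'a) set"
  assumes fin: "finite (carrier G)"
    and perm: "g \<in> U \<Longrightarrow> g permutes carrier G"
    and comp_closed: "g \<in> U \<Longrightarrow> h \<in> U \<Longrightarrow> g \<circ> h \<in> U"
    and shifts_subset: "shifts \<subseteq> U"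
begin

lemma act_closed [simp]: "g \<in> U \<Longrightarrow> x \<in> carrier G \<Longrightarrow> g x \<in> carrier G"
  by (simp add: permutes_in_image[OF perm])

lemma eqI:
  assumes "g \<in> U" "h \<in> U" "\<And>x. x \<in> carrier G \<Longrightarrow> g x = h x"
  shows "g = h"
proof (rule ext)
  fix x show "g x = h x"
    using assms(3) permutes_not_in[OF perm[OF assms(1)]] permutes_not_in[OF perm[OF assms(2)]]
    by (cases "x \<in> carrier G") simp_all
qed

lemma shift_in [simp]: "a \<in> carrier G \<Longrightarrow> shift a \<in> U"
  using shifts_subset by (auto simp: shifts_def)

lemma id_in [simp]: "id \<in> U"
proof -
  have "id = shift \<one>"
    by (auto simp: shift_def fun_eq_iff)
  then show ?thesis using shift_in[of \<one>] by simp
qed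

lemma in_shiftsI:
  assumes "g \<in> U" "a \<in> carrier G" "\<And>x. x \<in> carrier G \<Longrightarrow> g x = x \<otimes> a"
  shows "g \<in> shifts"
proof -
  have "g = shift a"
    using assms(1) shift_in[OF assms(2)] by (rule eqI) (simp add: shift_def assms(3))
  then show ?thesis using assms(2) by (auto simp: shifts_def)
qed

lemma finite_U: "finite U"
  by (rule finite_subset[OF _ finite_permutations[OF fin]]) (blast intro: perm)

text \<open>Closure under composition makes \<open>U\<close> a group because \<open>U\<close> is
  finite: composing with \<open>g\<close> is an injection of \<open>U\<close> into itself, so it
  hits \<open>id\<close>.\<close>

lemma ex_inverse:
  assumes g: "g \<in> U"
  shows "\<exists>h\<in>U. h \<circ> g = id \<and> g \<circ> h = id"
proof -
  have "bij g"
    using perm[OF g] by (rule permutes_bij)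
  have "inj_on (\<lambda>h. h \<circ> g) U"
    using bij_is_surj[OF \<open>bij g\<close>] by (intro inj_onI) (simp add: surj_fun_eq)
  then have "(\<lambda>h. h \<circ> g) ` U = U"
    using g by (intro endo_inj_surj finite_U) (auto intro: comp_closed)
  then have "id \<in> (\<lambda>h. h \<circ> g) ` U"
    using id_in by (rule ssubst)
  then obtain h where h: "h \<in> U" "id = h \<circ> g"
    by (rule imageE)
  have "g \<circ> h = id"
  proof (rule ext)
    fix x
    obtain y where "x = g y"
      using surjD[OF bij_is_surj[OF \<open>bij g\<close>]] by blast
    then show "(g \<circ> h) x = id x"
      using fun_cong[OF h(2), of y] by simp
  qed
  then show ?thesis
    using h by (intro bexI[of _ h]) simp_all
qed

section \<open>Centre, stabiliser and transfer\<close>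

text \<open>Via \<open>shift\<close>, this is the intersection of the centre of \<open>U\<close>
  with the regular subgroup \<open>shifts\<close>.\<close>

definition Z where
  "Z = {z \<in> carrier G. \<forall>g\<in>U. \<forall>x\<in>carrier G. g (x \<otimes> z) = g x \<otimes> z}"

lemma ZI:
  assumes "z \<in> carrier G" "\<And>g x. g \<in> U \<Longrightarrow> x \<in> carrier G \<Longrightarrow> g (x \<otimes> z) = g x \<otimes> z"
  shows "z \<in> Z"
  using assms by (simp add: Z_def)

lemma Z_act: "z \<in> Z \<Longrightarrow> g \<in> U \<Longrightarrow> x \<in> carrier G \<Longrightarrow> g (x \<otimes> z) = g x \<otimes> z"
  by (simp add: Z_def)

lemma Z_closed [simp]: "z \<in> Z \<Longrightarrow> z \<in> carrier G"
  by (simp add: Z_def)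

lemma subgroup_Z: "subgroup Z G"
proof (rule subgroupI)
  have "\<one> \<in> Z" by (rule ZI) simp_all
  then show "Z \<noteq> {}" by blast
next
  fix a assume a: "a \<in> Z"
  then have ac: "a \<in> carrier G" by simp
  show "inv a \<in> Z"
  proof (rule ZI)
    fix g x assume g: "g \<in> U" and x: "x \<in> carrier G"
    have "g (x \<otimes> inv a \<otimes> a) = g (x \<otimes> inv a) \<otimes> a"
      using a ac g x by (simp add: Z_act)
    then have "g (x \<otimes> inv a) \<otimes> a = g x"
      using ac x by (simp add: m_assoc)
    then show "g (x \<otimes> inv a) = g x \<otimes> inv a"
      using ac g x by (simp add: inv_solve_right)
  qed (simp add: ac)
next
  fix a b assume "a \<in> Z" "b \<in> Z"
  then show "a \<otimes> b \<in> Z"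
    by (intro ZI) (simp_all add: Z_act flip: m_assoc)
qed auto

definition stab where "stab = {t \<in> U. t \<one> = \<one>}"

lemma stabI: "t \<in> U \<Longrightarrow> t \<one> = \<one> \<Longrightarrow> t \<in> stab"
  by (simp add: stab_def)

lemma stab_in [simp]: "t \<in> stab \<Longrightarrow> t \<in> U"
  and stab_one [simp]: "t \<in> stab \<Longrightarrow> t \<one> = \<one>"
  by (simp_all add: stab_def)

lemma stab_comp: "s \<in> stab \<Longrightarrow> t \<in> stab \<Longrightarrow> s \<circ> t \<in> stab"
  by (intro stabI) (simp_all add: comp_closed)

lemma id_stab [simp]: "id \<in> stab"
  by (intro stabI) simp_all

lemma finite_stab: "finite stab"
  using finite_U by (rule rev_finite_subset) (blast intro: stab_in)

lemma stab_shifts: "t \<in> stab \<Longrightarrow> t \<in> shifts \<Longrightarrow> t = id"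
  by (drule stab_one) (auto simp: shifts_def shift_def fun_eq_iff)

lemma Z_fixed: "t \<in> stab \<Longrightarrow> z \<in> Z \<Longrightarrow> t z = z"
  using Z_act[of z t \<one>] by simp

text \<open>Every element of \<open>U\<close> is uniquely a shift after an element of the stabiliser of \<open>\<one>\<close>; \<open>res\<close> is
  the latter.\<close>

definition res where "res g = shift (inv (g \<one>)) \<circ> g"

lemma res_apply: "g \<in> U \<Longrightarrow> x \<in> carrier G \<Longrightarrow> res g x = g x \<otimes> inv (g \<one>)"
  by (simp add: res_def)

lemma res_stab: "g \<in> U \<Longrightarrow> res g \<in> stab"
  by (intro stabI) (simp_all add: res_apply, simp add: res_def comp_closed)

text \<open>\<open>stab\<close> is a transversal of the cosets of \<open>shifts\<close> in
  \<open>U\<close>, and the map is right multiplication by \<open>g\<close> on these cosets, read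
  off on representatives.\<close>

lemma inj_on_res_comp:
  assumes g: "g \<in> U"
  shows "inj_on (\<lambda>t. res (t \<circ> g)) stab"
proof (rule inj_onI)
  fix t t' assume t: "t \<in> stab" "t' \<in> stab" and eq: "res (t \<circ> g) = res (t' \<circ> g)"
  obtain h where h: "h \<in> U" "g \<circ> h = id"
    using ex_inverse[OF g] by blast
  have gh: "g (h x) = x" for x
    using h(2) by (simp add: fun_eq_iff)
  have *: "t x \<otimes> inv (t (g \<one>)) = t' x \<otimes> inv (t' (g \<one>))" if "x \<in> carrier G" for x
    using fun_cong[OF eq, of "h x"] that t g h(1) by (simp add: res_apply comp_closed gh)
  \<comment> \<open>Both \<open>t\<close> and \<open>t'\<close> fix \<open>\<one>\<close>, so at
    \<open>\<one>\<close> only the normalising factors remain.\<close>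
  have "inv (t (g \<one>)) = inv (t' (g \<one>))"
    using *[of \<one>] t g by simp
  then show "t = t'"
    using * t g by (intro eqI) auto
qed

lemma res_comp_image: "g \<in> U \<Longrightarrow> (\<lambda>t. res (t \<circ> g)) ` stab = stab"
  by (intro endo_inj_surj finite_stab inj_on_res_comp) (auto simp: res_stab comp_closed)

text \<open>Since \<open>t \<circ> g = shift (t (g \<one>)) \<circ> res (t \<circ> g)\<close>, the
  group-theoretic transfer of \<open>g\<close> from \<open>U\<close> to the abelian group
  \<open>shifts\<close>, for the transversal \<open>stab\<close>, is the shift by
  \<open>transfer (g \<one>)\<close>.\<close>

definition transfer where "transfer x = (\<Otimes>t\<in>stab. t x)"

lemma transfer_closed [simp]: "x \<in> carrier G \<Longrightarrow> transfer x \<in> carrier G"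
  unfolding transfer_def by (rule finprod_closed) auto

text \<open>This is the homomorphism property of the transfer: each factor \<open>t (g x)\<close>
  splits into \<open>res (t \<circ> g) x\<close> and \<open>t (g \<one>)\<close>, and
  \<open>t \<mapsto> res (t \<circ> g)\<close> permutes \<open>stab\<close>. For \<open>g\<close> in
  \<open>stab\<close> it makes \<open>transfer\<close> constant on orbits.\<close>

lemma transfer_act:
  assumes g: "g \<in> U" and x: "x \<in> carrier G"
  shows "transfer (g x) = transfer x \<otimes> transfer (g \<one>)"
proof -
  have "transfer (g x) = (\<Otimes>t\<in>stab. res (t \<circ> g) x \<otimes> t (g \<one>))"
    unfolding transfer_def
    using g x by (intro finprod_cong') (auto simp: res_apply comp_closed m_assoc)
  also have "\<dots> = (\<Otimes>t\<in>stab. res (t \<circ> g) x) \<otimes> (\<Otimes>t\<in>stab. t (g \<one>))"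
    using g x by (intro finprod_multf) (auto simp: res_stab comp_closed)
  also have "(\<Otimes>t\<in>stab. res (t \<circ> g) x) = (\<Otimes>t\<in>(\<lambda>t. res (t \<circ> g)) ` stab. t x)"
    using g x by (intro finprod_reindex[symmetric] inj_on_res_comp) (auto simp: res_stab comp_closed)
  finally show ?thesis
    by (simp add: res_comp_image g transfer_def)
qed

end

section \<open>Maximal self-normalising regular subgroup\<close>

text \<open>In group terms, \<open>shifts\<close> is a maximal subgroup of \<open>U\<close> and
  equals its own normaliser: the premise on \<open>g\<close> says that conjugation by
  \<open>g\<close> takes shifts to shifts.\<close>

locale minimal_overgroup = regular_overgroup +
  assumes proper: "U \<noteq> shifts"
    and minimal: "\<And>C. \<lbrakk>shifts \<subseteq> C; C \<subseteq> U; \<And>g h. g \<in> C \<Longrightarrow> h \<in> C \<Longrightarrow> g \<circ> h \<in> C\<rbrakk> \<Longrightarrow> C = shifts \<or> C = U"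
    and self_normalising: "\<And>g. \<lbrakk>g \<in> U;
      \<And>a. a \<in> carrier G \<Longrightarrow> \<exists>b\<in>carrier G. \<forall>x\<in>carrier G. g (x \<otimes> a) = g x \<otimes> b\<rbrakk> \<Longrightarrow> g \<in> shifts"
begin

text \<open>Here \<open>shift b\<close> is the conjugate of \<open>shift a\<close> by \<open>g\<close>, so its centraliser
  contains all shifts and their conjugates, and by minimality of \<open>U\<close> it is \<open>U\<close>.\<close>

lemma intertwined_central:
  assumes g: "g \<in> U" "g \<notin> shifts" and ab: "a \<in> carrier G" "b \<in> carrier G"
    and eq: "\<And>x. x \<in> carrier G \<Longrightarrow> g (x \<otimes> a) = g x \<otimes> b"
  shows "a \<in> Z" "b \<in> Z"
proof -
  obtain h where h: "h \<in> U" "h \<circ> g = id" "g \<circ> h = id"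
    using ex_inverse[OF g(1)] by blast
  have hg: "h (g x) = x" and gh: "g (h x) = x" for x
    using h(2,3) by (simp_all add: fun_eq_iff)
  define C where "C = {f \<in> U. \<forall>x\<in>carrier G. f (x \<otimes> b) = f x \<otimes> b}"
  have "shifts \<subseteq> C"
    using ab by (auto simp: C_def shifts_def) (simp add: shift_def m_ac)
  moreover have "C \<subseteq> U"
    by (auto simp: C_def)
  moreover have "f \<circ> f' \<in> C" if "f \<in> C" "f' \<in> C" for f f'
    using that ab by (simp add: C_def comp_closed)
  ultimately have "C = shifts \<or> C = U"
    by (rule minimal)
  moreover have "C \<noteq> shifts"
  proof
    assume C: "C = shifts"
    \<comment> \<open>The conjugate of \<open>shift c\<close> by \<open>g\<close> commutes with
      \<open>shift b\<close>, because \<open>shift c\<close> commutes with \<open>shift a\<close>.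
      If all of \<open>C\<close> consists of shifts, then \<open>g\<close> normalises
      \<open>shifts\<close>.\<close>
    have "\<exists>d\<in>carrier G. \<forall>x\<in>carrier G. g (x \<otimes> c) = g x \<otimes> d" if c: "c \<in> carrier G" for c
    proof -
      have hb: "h (x \<otimes> b) = h x \<otimes> a" if "x \<in> carrier G" for x
        using eq[of "h x"] that h(1) hg by (metis act_closed gh)
      have "g \<circ> shift c \<circ> h \<in> C"
      proof -
        have "g (h (x \<otimes> b) \<otimes> c) = g (h x \<otimes> c) \<otimes> b" if x: "x \<in> carrier G" for x
        proof -
          have "h (x \<otimes> b) \<otimes> c = h x \<otimes> c \<otimes> a"
            using x h(1) c ab by (simp add: hb m_assoc m_comm[of a c])
          then show ?thesis
            using eq[of "h x \<otimes> c"] x h(1) c by simp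
        qed
        then show ?thesis
          using g(1) h(1) c ab by (simp add: C_def comp_closed)
      qed
      then obtain d where d: "d \<in> carrier G" "g \<circ> shift c \<circ> h = shift d"
        using C by (auto simp: shifts_def)
      have "g (x \<otimes> c) = g x \<otimes> d" if "x \<in> carrier G" for x
        using fun_cong[OF d(2), of "g x"] that g(1) by (simp add: hg)
      then show ?thesis using d(1) by blast
    qed
    then show False
      using self_normalising g by blast
  qed
  ultimately have "C = U" by blast
  then show bZ: "b \<in> Z"
    using ab by (intro ZI) (auto simp: C_def)
  have "g (\<one> \<otimes> a) = g (\<one> \<otimes> b)"
    using eq[of \<one>] Z_act[OF bZ g(1), of \<one>] by simp
  then have "a = b"
    using ab hg by (metis l_one)
  then show "a \<in> Z" using bZ by simp
qed

section \<open>Double cosets and the transfer modulo the centre\<close>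

definition double_coset where
  "double_coset t = {shift y \<circ> t \<circ> shift x | x y. x \<in> carrier G \<and> y \<in> carrier G}"

lemma shift_comp: "a \<in> carrier G \<Longrightarrow> b \<in> carrier G \<Longrightarrow> shift a \<circ> shift b = shift (a \<otimes> b)"
proof (rule ext)
  fix x assume "a \<in> carrier G" "b \<in> carrier G"
  then show "(shift a \<circ> shift b) x = shift (a \<otimes> b) x"
    by (cases "x \<in> carrier G") (simp_all add: shift_def m_ac)
qed

lemma double_coset_self: "t \<in> U \<Longrightarrow> t \<in> double_coset t"
proof -
  assume "t \<in> U"
  have "t = shift \<one> \<circ> t \<circ> shift \<one>"
    using \<open>t \<in> U\<close> by (intro eqI comp_closed) auto
  then show ?thesis
    unfolding double_coset_def by blast
qed

lemma double_coset_trans: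
  assumes "s \<in> double_coset t" "t \<in> double_coset r"
  shows "s \<in> double_coset r"
proof -
  obtain x y where xy: "x \<in> carrier G" "y \<in> carrier G" "s = shift y \<circ> t \<circ> shift x"
    using assms(1) by (auto simp: double_coset_def)
  obtain x' y' where xy': "x' \<in> carrier G" "y' \<in> carrier G" "t = shift y' \<circ> r \<circ> shift x'"
    using assms(2) by (auto simp: double_coset_def)
  have "s = (shift y \<circ> shift y') \<circ> r \<circ> (shift x' \<circ> shift x)"
    by (simp add: xy(3) xy'(3) comp_assoc)
  then have "s = shift (y \<otimes> y') \<circ> r \<circ> shift (x' \<otimes> x)"
    using xy xy' by (simp add: shift_comp)
  then show ?thesis
    using xy xy' unfolding double_coset_def by blast
qed

lemma double_coset_sym:
  assumes "s \<in> double_coset t" "t \<in> U"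
  shows "t \<in> double_coset s"
proof -
  obtain x y where xy: "x \<in> carrier G" "y \<in> carrier G" "s = shift y \<circ> t \<circ> shift x"
    using assms(1) by (auto simp: double_coset_def)
  have "t = shift (inv y) \<circ> s \<circ> shift (inv x)"
    unfolding xy(3) using xy(1,2) assms(2) by (intro eqI comp_closed) (auto simp: m_assoc)
  then show ?thesis
    using xy(1,2) unfolding double_coset_def by blast
qed

lemma double_coset_eq:
  assumes "s \<in> double_coset t" "t \<in> U"
  shows "double_coset s = double_coset t"
proof (intro equalityI subsetI)
  show "r \<in> double_coset t" if "r \<in> double_coset s" for r
    using that assms(1) by (rule double_coset_trans)
  show "r \<in> double_coset s" if "r \<in> double_coset t" for r
    using that double_coset_sym[OF assms] by (rule double_coset_trans)
qed

text \<open>The chosen \<open>r\<close> depends on \<open>t\<close> only through its double coset,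
  so members of one double coset are compared with the same \<open>r\<close>. For \<open>t\<close>
  outside \<open>shifts\<close>, \<open>intertwined_central\<close> makes the left factor unique
  modulo \<open>Z\<close>.\<close>

definition left_part where
  "left_part t = (SOME y. y \<in> carrier G \<and>
     (\<exists>x\<in>carrier G. t = shift y \<circ> (SOME r. r \<in> double_coset t) \<circ> shift x))"

lemma left_part:
  assumes "t \<in> U" and r: "r = (SOME r. r \<in> double_coset t)"
  shows "r \<in> double_coset t"
    and "left_part t \<in> carrier G"
    and "\<exists>x\<in>carrier G. t = shift (left_part t) \<circ> r \<circ> shift x"
proof -
  show rD: "r \<in> double_coset t"
    using double_coset_self[OF assms(1)] unfolding r by (rule someI[of "\<lambda>r. r \<in> double_coset t"])
  have "t \<in> double_coset r"
    using rD assms(1) by (rule double_coset_sym)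
  then have "\<exists>y. y \<in> carrier G \<and> (\<exists>x\<in>carrier G. t = shift y \<circ> r \<circ> shift x)"
    unfolding double_coset_def by blast
  then have "left_part t \<in> carrier G \<and> (\<exists>x\<in>carrier G. t = shift (left_part t) \<circ> r \<circ> shift x)"
    unfolding left_part_def r by (rule someI_ex)
  then show "left_part t \<in> carrier G" "\<exists>x\<in>carrier G. t = shift (left_part t) \<circ> r \<circ> shift x"
    by blast+
qed

text \<open>Modulo \<open>Z\<close>, the factor \<open>t a\<close> is a coboundary on the stabiliser minus the identity, which
  makes the product of these factors telescope in the transfer.\<close>

lemma left_part_res:
  assumes t: "t \<in> stab" "t \<noteq> id" and a: "a \<in> carrier G"
  shows "inv (t a) \<otimes> left_part t \<otimes> inv (left_part (res (t \<circ> shift a))) \<in> Z"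
proof -
  let ?s = "res (t \<circ> shift a)"
  have s: "?s \<in> U" "t \<in> U"
    using t a by (simp_all add: res_stab comp_closed)
  have "?s = shift (inv (t a)) \<circ> t \<circ> shift a"
    using a by (simp add: res_def comp_assoc)
  then have "?s \<in> double_coset t"
    using t(1) a unfolding double_coset_def by (blast intro: inv_closed act_closed stab_in)
  then have D: "double_coset ?s = double_coset t"
    using s by (simp add: double_coset_eq)
  define r where "r = (SOME r. r \<in> double_coset t)"
  note lt = left_part[OF s(2) r_def]
  have r': "r = (SOME r. r \<in> double_coset ?s)"
    unfolding D r_def ..
  note ls = left_part[OF s(1) r']
  obtain x where x: "x \<in> carrier G" "t = shift (left_part t) \<circ> r \<circ> shift x"
    using lt by blast
  obtain x' where x': "x' \<in> carrier G" "?s = shift (left_part ?s) \<circ> r \<circ> shift x'"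
    using ls by blast
  have rU: "r \<in> U"
    using lt(1) s(2) by (auto simp: double_coset_def intro!: comp_closed)
  have "r \<notin> shifts"
  proof
    assume "r \<in> shifts"
    then have "t \<in> shifts"
      using x lt(2) by (auto simp: shifts_def shift_comp)
    then show False using t stab_shifts by blast
  qed
  define y where "y = left_part t"
  define y' where "y' = left_part ?s"
  have yc: "y \<in> carrier G" "y' \<in> carrier G"
    using lt ls by (simp_all add: y_def y'_def)
  have ta: "t a \<in> carrier G"
    using t a by simp
  have *: "r (w \<otimes> x') \<otimes> y' = r (w \<otimes> a \<otimes> x) \<otimes> y \<otimes> inv (t a)" if w: "w \<in> carrier G" for w
  proof -
    have "?s w = r (w \<otimes> x') \<otimes> y'"
      using fun_cong[OF x'(2), of w] w x'(1) rU by (simp add: y'_def)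
    moreover have "?s w = t (w \<otimes> a) \<otimes> inv (t a)"
      using w a t by (simp add: res_apply comp_closed)
    moreover have "t (w \<otimes> a) = r (w \<otimes> a \<otimes> x) \<otimes> y"
      using fun_cong[OF x(2), of "w \<otimes> a"] w a x(1) rU by (simp add: y_def)
    ultimately show ?thesis by simp
  qed
  \<comment> \<open>Replacing \<open>w\<close> by \<open>w \<otimes> inv (a \<otimes> x)\<close> in
    \<open>*\<close> shows that \<open>r\<close> intertwines two shifts, so both shift amounts are
    central.\<close>
  have "r (w \<otimes> (x' \<otimes> inv (a \<otimes> x))) = r w \<otimes> (inv (t a) \<otimes> y \<otimes> inv y')" if w: "w \<in> carrier G" for w
  proof -
    have 1: "w \<otimes> inv (a \<otimes> x) \<otimes> x' = w \<otimes> (x' \<otimes> inv (a \<otimes> x))"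
      using w x(1) x'(1) a by (simp add: m_ac)
    have 2: "w \<otimes> inv (a \<otimes> x) \<otimes> a \<otimes> x = w"
      using w x(1) a by (simp add: m_assoc)
    have "r (w \<otimes> (x' \<otimes> inv (a \<otimes> x))) \<otimes> y' = r w \<otimes> y \<otimes> inv (t a)"
      using *[of "w \<otimes> inv (a \<otimes> x)"] w x(1) a unfolding 1 2 by simp
    then have "r (w \<otimes> (x' \<otimes> inv (a \<otimes> x))) = r w \<otimes> y \<otimes> inv (t a) \<otimes> inv y'"
      by (rule eq_mult_inv) (use w x(1) x'(1) a yc rU in auto)
    then show ?thesis
      using w yc ta rU by (simp add: m_ac)
  qed
  then have "inv (t a) \<otimes> y \<otimes> inv y' \<in> Z"
    by (rule intertwined_central(2)[OF rU \<open>r \<notin> shifts\<close>, rotated 2])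
      (use x(1) x'(1) a yc ta in simp_all)
  then show ?thesis by (simp add: y_def y'_def)
qed

text \<open>The factor of \<open>id\<close> is \<open>a\<close>. By \<open>left_part_res\<close>,
  every other factor is, modulo \<open>Z\<close>, a quotient of \<open>left_part\<close> at
  \<open>t\<close> and at \<open>res (t \<circ> shift a)\<close>; as the latter runs through
  \<open>stab - {id}\<close> again, these quotients cancel in the product.\<close>

lemma transfer_coset:
  assumes a: "a \<in> carrier G"
  shows "transfer a \<otimes> inv a \<in> Z"
proof -
  let ?T = "stab - {id}"
  let ?s = "\<lambda>t. res (t \<circ> shift a)"
  let ?c = "\<lambda>t. inv (t a) \<otimes> left_part t \<otimes> inv (left_part (?s t))"
  have lp: "left_part t \<in> carrier G" if "t \<in> U" for t
    using left_part(2)[OF that] by blast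
  have s: "?s t \<in> stab" if "t \<in> stab" for t
    using that a by (simp add: res_stab comp_closed)
  \<comment> \<open>The reindexing fixes \<open>id\<close>, so it restricts to a permutation of
    \<open>?T\<close>.\<close>
  have sid: "?s id = id"
    using a s[of id] by (intro eqI) (auto simp: res_apply m_assoc)
  have inj: "inj_on ?s stab"
    using a by (simp add: inj_on_res_comp)
  have "?s ` ?T = ?s ` stab - {id}"
    using inj_on_image_set_diff[OF inj, of stab "{id}"] sid by simp
  then have sT: "?s ` ?T = ?T"
    using a by (simp add: res_comp_image)
  have c: "finprod G ?c ?T \<in> Z"
    using a left_part_res by (intro finprod_in_subgroup subgroup_Z) auto
  have "(\<Otimes>t\<in>?T. left_part t) = (\<Otimes>t\<in>?T. t a \<otimes> (?c t \<otimes> left_part (?s t)))"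
  proof (rule finprod_cong')
    fix t assume t: "t \<in> ?T"
    then have "left_part t \<in> carrier G" "left_part (?s t) \<in> carrier G" "t a \<in> carrier G"
      using a s lp by simp_all
    then show "left_part t = t a \<otimes> (?c t \<otimes> left_part (?s t))"
      by (simp add: m_assoc) (simp flip: m_assoc)
  qed (use a s lp in auto)
  also have "\<dots> = (\<Otimes>t\<in>?T. t a) \<otimes> (finprod G ?c ?T \<otimes> (\<Otimes>t\<in>?T. left_part (?s t)))"
    using a s lp by (subst finprod_multf; (subst finprod_multf)?; auto)
  also have "(\<Otimes>t\<in>?T. left_part (?s t)) = (\<Otimes>t\<in>?s ` ?T. left_part t)"
    using inj s lp by (intro finprod_reindex[symmetric]) (auto intro: inj_on_subset)
  also have "\<dots> = (\<Otimes>t\<in>?T. left_part t)"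
    unfolding sT ..
  finally have "(\<Otimes>t\<in>?T. t a) \<otimes> finprod G ?c ?T = \<one>"
  proof -
    assume e: "(\<Otimes>t\<in>?T. left_part t) = (\<Otimes>t\<in>?T. t a) \<otimes> (finprod G ?c ?T \<otimes> (\<Otimes>t\<in>?T. left_part t))"
    have "(\<Otimes>t\<in>?T. left_part t) \<in> carrier G" "(\<Otimes>t\<in>?T. t a) \<in> carrier G"
      using a lp by (auto intro!: finprod_closed)
    then show ?thesis
      using e Z_closed[OF c] by (intro mult_eq_one_if_absorbed)
  qed
  then have "(\<Otimes>t\<in>?T. t a) = inv (finprod G ?c ?T)"
    using a Z_closed[OF c] by (intro inv_equality[symmetric]) (auto intro!: finprod_closed)
  then have Tz: "(\<Otimes>t\<in>?T. t a) \<in> Z"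
    using c subgroup_Z by (simp add: subgroup.m_inv_closed)
  have "transfer a = (\<Otimes>t\<in>insert id ?T. t a)"
    by (simp add: transfer_def insert_absorb)
  also have "\<dots> = a \<otimes> (\<Otimes>t\<in>?T. t a)"
    using a finite_stab by (subst finprod_insert) auto
  finally have "transfer a \<otimes> inv a = (\<Otimes>t\<in>?T. t a)"
    using a Z_closed[OF Tz] by (simp add: m_comm[OF a] m_assoc)
  then show ?thesis using Tz by simp
qed

text \<open>\<open>a\<close> and \<open>t a\<close> have the same transfer, and by
  \<open>transfer_coset\<close> each lies in the \<open>Z\<close>-coset of its transfer.\<close>

lemma stab_coset:
  assumes t: "t \<in> stab" and a: "a \<in> carrier G"
  shows "t a \<otimes> inv a \<in> Z"
proof -
  have ta: "t a \<in> carrier G" using t a by simp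
  have "transfer \<one> = \<one>"
    unfolding transfer_def by (rule finprod_one_eqI) simp
  then have V: "transfer (t a) = transfer a"
    using transfer_act[of t a] t a by simp
  have "(transfer a \<otimes> inv a) \<otimes> inv (transfer (t a) \<otimes> inv (t a)) \<in> Z"
    using transfer_coset[OF a] transfer_coset[OF ta] subgroup_Z
    by (simp add: subgroup.m_closed subgroup.m_inv_closed)
  also have "(transfer a \<otimes> inv a) \<otimes> inv (transfer (t a) \<otimes> inv (t a)) = t a \<otimes> inv a"
  proof -
    have V': "transfer a \<in> carrier G" using a by simp
    have "(transfer a \<otimes> inv a) \<otimes> inv (transfer a \<otimes> inv (t a))
        = (transfer a \<otimes> inv (transfer a)) \<otimes> (t a \<otimes> inv a)"
      using a ta V' by (simp add: inv_mult m_ac del: r_inv)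
    then show ?thesis
      unfolding V using a ta V' by simp
  qed
  finally show ?thesis .
qed

section \<open>Commutators of the stabiliser with shifts\<close>

lemma stab_coset_obtain:
  assumes "t \<in> stab" "a \<in> carrier G"
  obtains z where "z \<in> Z" "t a = a \<otimes> z"
proof
  show "t a \<otimes> inv a \<in> Z" using assms by (rule stab_coset)
  show "t a = a \<otimes> (t a \<otimes> inv a)" using assms by (simp add: m_lcomm[of a "t a"])
qed

text \<open>\<open>d\<close> is the commutator of \<open>s\<close> and \<open>shift b\<close> up to an element of \<open>Z\<close>. Apart from
  \<open>d x\<close> on the left and \<open>x\<close> on the right the equation is symmetric in \<open>x\<close> and \<open>b\<close>.\<close>

lemma commutator_exists:
  assumes s: "s \<in> stab" and b: "b \<in> carrier G"
  shows "\<exists>d\<in>stab. \<forall>x\<in>carrier G. d x \<otimes> s x \<otimes> s b = s (x \<otimes> b) \<otimes> x"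
proof -
  obtain h where h: "h \<in> U" "h \<circ> s = id" "s \<circ> h = id"
    using ex_inverse[of s] s by auto
  have h1: "h \<one> = \<one>"
    using fun_cong[OF h(2), of \<one>] s by simp
  \<comment> \<open>This is \<open>s \<circ> shift b \<circ> h\<close>, the conjugate of
    \<open>shift b\<close> by \<open>s\<close>, followed by the shift that brings
    \<open>\<one>\<close> back to \<open>\<one>\<close>.\<close>
  let ?d = "res (s \<circ> shift b) \<circ> h"
  have "?d \<in> stab"
    using s b h h1 by (intro stab_comp res_stab) (auto simp: comp_closed intro: stabI)
  moreover have "?d x \<otimes> s x \<otimes> s b = s (x \<otimes> b) \<otimes> x" if x: "x \<in> carrier G" for x
  proof -
    obtain z where z: "z \<in> Z" "s x = x \<otimes> z"
      using stab_coset_obtain[OF s x] .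
    \<comment> \<open>On the \<open>Z\<close>-coset of \<open>x\<close> the map \<open>s\<close> is
      translation by \<open>z\<close>, so its inverse \<open>h\<close> is translation by
      \<open>inv z\<close>.\<close>
    have "h (s x) = x" using h(2) by (simp add: fun_eq_iff)
    then have "h x \<otimes> z = x"
      using z h(1) x by (simp add: Z_act)
    then have hx: "h x = x \<otimes> inv z"
      using z(1) h(1) x by (intro eq_mult_inv) auto
    have "?d x = s (h x \<otimes> b) \<otimes> inv (s b)"
      using s b h(1) x by (simp add: res_apply comp_closed)
    moreover have "h x \<otimes> b = x \<otimes> b \<otimes> inv z"
      using x b z(1) by (simp add: hx m_ac)
    moreover have "s (x \<otimes> b \<otimes> inv z) = s (x \<otimes> b) \<otimes> inv z"
      using s x b z(1) subgroup.m_inv_closed[OF subgroup_Z] by (intro Z_act) auto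
    ultimately have "?d x = s (x \<otimes> b) \<otimes> inv z \<otimes> inv (s b)"
      by simp
    moreover have "p \<otimes> inv z \<otimes> inv q \<otimes> (x \<otimes> z) \<otimes> q = p \<otimes> x"
      if "p \<in> carrier G" "q \<in> carrier G" for p q
    proof -
      have "p \<otimes> inv z \<otimes> inv q \<otimes> (x \<otimes> z) \<otimes> q = p \<otimes> x \<otimes> (z \<otimes> inv z) \<otimes> (q \<otimes> inv q)"
        using that x Z_closed[OF z(1)] by (simp only: m_ac m_closed inv_closed)
      then show ?thesis
        using that x Z_closed[OF z(1)] by simp
    qed
    ultimately show ?thesis
      using s x b z(2) by simp
  qed
  ultimately show ?thesis by blast
qed

text \<open>If \<open>s\<close> and \<open>s'\<close> have the same commutator with
  \<open>b\<close>, then \<open>r\<close>, the inverse of \<open>s'\<close> after \<open>s\<close>,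
  conjugates \<open>shift b\<close> to \<open>shift (r b)\<close>. As \<open>b\<close> is not
  central, \<open>r\<close> is a shift; fixing \<open>\<one>\<close>, it is the identity.\<close>

lemma commutator_inj:
  assumes s: "s \<in> stab" "s' \<in> stab" and b: "b \<in> carrier G" "b \<notin> Z" and d: "d \<in> stab"
    and eq: "\<And>x. x \<in> carrier G \<Longrightarrow> d x \<otimes> s x \<otimes> s b = s (x \<otimes> b) \<otimes> x"
    and eq': "\<And>x. x \<in> carrier G \<Longrightarrow> d x \<otimes> s' x \<otimes> s' b = s' (x \<otimes> b) \<otimes> x"
  shows "s = s'"
proof -
  obtain h where h: "h \<in> U" "h \<circ> s' = id" "s' \<circ> h = id"
    using ex_inverse[of s'] s by auto
  have "h \<one> = \<one>"
    using fun_cong[OF h(2), of \<one>] s by simp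
  define r where "r = h \<circ> s"
  have r: "r \<in> stab"
    using s h \<open>h \<one> = \<one>\<close> unfolding r_def by (intro stab_comp stabI) simp_all
  have sr: "s' (r x) = s x" for x
    using h(3) by (simp add: r_def fun_eq_iff)
  have "r (x \<otimes> b) = r x \<otimes> r b" if x: "x \<in> carrier G" for x
  proof -
    obtain z where z: "z \<in> Z" "r x = x \<otimes> z"
      using stab_coset_obtain[OF r x] .
    obtain w where w: "w \<in> Z" "r b = b \<otimes> w"
      using stab_coset_obtain[OF r b(1)] .
    obtain v where v: "v \<in> Z" "r (x \<otimes> b) = x \<otimes> b \<otimes> v"
      using stab_coset_obtain[OF r, of "x \<otimes> b"] x b by auto
    have e: "s x = s' x \<otimes> z" "s b = s' b \<otimes> w" "s (x \<otimes> b) = s' (x \<otimes> b) \<otimes> v"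
      using sr[of x] sr[of b] sr[of "x \<otimes> b"] z w v s x b by (simp_all add: Z_act)
    have c: "d x \<in> carrier G" "s' x \<in> carrier G" "s' b \<in> carrier G" "s' (x \<otimes> b) \<in> carrier G"
      "z \<in> carrier G" "w \<in> carrier G" "v \<in> carrier G"
      using x b s d z w v by simp_all
    \<comment> \<open>Passing from \<open>s'\<close> to \<open>s\<close> multiplies the values at
      \<open>x\<close>, \<open>b\<close> and \<open>x \<otimes> b\<close> by \<open>z\<close>,
      \<open>w\<close> and \<open>v\<close>; comparing \<open>eq\<close> with \<open>eq'\<close>
      leaves \<open>z \<otimes> w = v\<close>.\<close>
    have "(s' (x \<otimes> b) \<otimes> x) \<otimes> (z \<otimes> w) = (s' (x \<otimes> b) \<otimes> x) \<otimes> v"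
    proof -
      have "(s' (x \<otimes> b) \<otimes> x) \<otimes> (z \<otimes> w) = (d x \<otimes> s' x \<otimes> s' b) \<otimes> (z \<otimes> w)"
        using eq'[OF x] by simp
      also have "\<dots> = d x \<otimes> s x \<otimes> s b"
        using c by (simp add: e m_ac)
      also have "\<dots> = (s' (x \<otimes> b) \<otimes> x) \<otimes> v"
        unfolding eq[OF x] e(3) using c x by (simp add: m_ac)
      finally show ?thesis .
    qed
    then have "z \<otimes> w = v"
      using c x by simp
    then show ?thesis
      using c x b z w v by (auto simp: m_ac)
  qed
  then have "r \<in> shifts"
    using intertwined_central(1)[of r b "r b"] r b by auto
  then have "r = id"
    using r stab_shifts by blast
  then show ?thesis
    using sr by (auto simp: fun_eq_iff)
qed

text \<open>An injective self-map of the finite set \<open>stab\<close> is onto, so every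
  \<open>t\<close> arises as a commutator with \<open>b\<close>.\<close>

lemma commutator_surj:
  assumes t: "t \<in> stab" and b: "b \<in> carrier G" "b \<notin> Z"
  shows "\<exists>s\<in>stab. \<forall>x\<in>carrier G. t x \<otimes> s x \<otimes> s b = s (x \<otimes> b) \<otimes> x"
proof -
  obtain D where D: "\<And>s. s \<in> stab \<Longrightarrow> D s \<in> stab"
    "\<And>s x. s \<in> stab \<Longrightarrow> x \<in> carrier G \<Longrightarrow> D s x \<otimes> s x \<otimes> s b = s (x \<otimes> b) \<otimes> x"
    using bchoice[of stab "\<lambda>s d. d \<in> stab \<and> (\<forall>x\<in>carrier G. d x \<otimes> s x \<otimes> s b = s (x \<otimes> b) \<otimes> x)"]
      commutator_exists b(1) by blast
  have "inj_on D stab"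
  proof (rule inj_onI)
    fix s s' assume s: "s \<in> stab" "s' \<in> stab" and "D s = D s'"
    then show "s = s'"
      using commutator_inj[OF s b D(1)[OF s(1)]] D(2)[OF s(1)] D(2)[OF s(2)] by simp
  qed
  then have "D ` stab = stab"
    using D(1) by (intro endo_inj_surj finite_stab) auto
  then obtain s where "s \<in> stab" "t = D s"
    using t by blast
  then show ?thesis using D(2) by blast
qed

text \<open>Write \<open>t\<close> as the commutator of some \<open>s\<close> with \<open>b\<close>,
  and let \<open>d\<close> be the commutator of the same \<open>s\<close> with \<open>a\<close>.
  Both \<open>t a \<otimes> inv a\<close> and \<open>d b \<otimes> inv b\<close> equal
  \<open>s (a \<otimes> b) \<otimes> inv (s a \<otimes> s b)\<close>.\<close>

lemma displacement_independent:
  assumes t: "t \<in> stab" "t a = k \<otimes> a" and k: "k \<in> carrier G"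
    and a: "a \<in> carrier G" and b: "b \<in> carrier G" "b \<notin> Z"
  shows "\<exists>d\<in>stab. d b = k \<otimes> b"
proof -
  obtain s where s: "s \<in> stab" "t a \<otimes> s a \<otimes> s b = s (a \<otimes> b) \<otimes> a"
    using commutator_surj[OF t(1) b] a by blast
  obtain d where d: "d \<in> stab" "d b \<otimes> s b \<otimes> s a = s (b \<otimes> a) \<otimes> b"
    using commutator_exists[OF s(1) a] b by blast
  have c: "s a \<in> carrier G" "s b \<in> carrier G" "s (a \<otimes> b) \<in> carrier G" "d b \<in> carrier G"
    using s d a b by simp_all
  have "(k \<otimes> s a \<otimes> s b) \<otimes> a = s (a \<otimes> b) \<otimes> a"
    using s(2) c k a unfolding t(2) by (simp add: m_ac)
  then have "k \<otimes> s a \<otimes> s b = s (a \<otimes> b)"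
    using c k a by simp
  then have "d b \<otimes> (s b \<otimes> s a) = (k \<otimes> b) \<otimes> (s b \<otimes> s a)"
    using d(2) c k a b by (simp add: m_ac flip: \<open>k \<otimes> s a \<otimes> s b = s (a \<otimes> b)\<close>)
  then have "d b = k \<otimes> b"
    using c k b by simp
  then show ?thesis using d(1) by blast
qed

text \<open>\<open>H\<close> is \<open>Z\<close>, and \<open>k\<close> is the displacement of one
  point moved by a nontrivial element of \<open>stab\<close>;
  \<open>displacement_independent\<close> carries it to all points outside \<open>Z\<close>.\<close>

theorem coset_structure:
  obtains H k where "subgroup H G" "H \<noteq> carrier G" "k \<in> H" "k \<noteq> \<one>"
    "\<forall>x\<in>carrier G - H. \<exists>t\<in>U. t \<one> = \<one> \<and> t x = k \<otimes> x"
proof -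
  obtain g where g: "g \<in> U" "g \<notin> shifts"
    using proper shifts_subset by blast
  have "res g \<noteq> id"
  proof
    assume "res g = id"
    then have "g x = x \<otimes> g \<one>" if "x \<in> carrier G" for x
      using res_apply[OF g(1) that] that g(1) by (simp add: inv_solve_right)
    then have "g \<in> shifts"
      by (rule in_shiftsI[OF g(1) act_closed[OF g(1) one_closed]])
    then show False
      using g by blast
  qed
  then obtain a where a: "a \<in> carrier G" "res g a \<noteq> a"
    using eqI[OF stab_in[OF res_stab[OF g(1)]] id_in] by auto
  define t where "t = res g"
  have t: "t \<in> stab" using g by (simp add: t_def res_stab)
  define k where "k = t a \<otimes> inv a"
  have kZ: "k \<in> Z"
    unfolding k_def using t a(1) by (rule stab_coset)
  have ta: "t a = k \<otimes> a"
    using t a(1) by (simp add: k_def m_assoc)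
  \<comment> \<open>Elements of \<open>stab\<close> fix \<open>Z\<close> pointwise, but
    \<open>t\<close> moves \<open>a\<close>.\<close>
  have "a \<notin> Z"
    using Z_fixed[OF t] a by (auto simp: t_def)
  show ?thesis
  proof (rule that[OF subgroup_Z])
    show "Z \<noteq> carrier G" using \<open>a \<notin> Z\<close> a(1) by blast
    show "k \<noteq> \<one>" using ta a by (auto simp: t_def)
    show "\<forall>x\<in>carrier G - Z. \<exists>t\<in>U. t \<one> = \<one> \<and> t x = k \<otimes> x"
    proof
      fix x assume "x \<in> carrier G - Z"
      then have "\<exists>d\<in>stab. d x = k \<otimes> x"
        using displacement_independent[OF t ta Z_closed[OF kZ] a(1)] by blast
      then show "\<exists>t\<in>U. t \<one> = \<one> \<and> t x = k \<otimes> x"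
        using stab_in stab_one by blast
    qed
  qed (fact kZ)
qed

end

section \<open>Cayley digraphs that are not DRRs\<close>

context group
begin

lemma perm_auto_few_fixed:
  assumes fin: "finite (carrier G)" and f: "f \<in> perm_autos" "f \<noteq> id"
  shows "2 * card {x \<in> carrier G. f x = x} \<le> card (carrier G)"
proof (rule card_proper_subgroup_le[OF _ subgroup_self _ fin])
  have "id \<in> hom G G" by (simp add: hom_def)
  then show "subgroup {x \<in> carrier G. f x = x} G"
    using subgroup_equalizer[of f id] f by (simp add: perm_autos_def)
  have "\<exists>x\<in>carrier G. f x \<noteq> x"
  proof (rule ccontr)
    assume "\<not> ?thesis"
    moreover have "f x = x" if "x \<notin> carrier G" for x
      using f(1) that by (auto simp: perm_autos_def intro: permutes_not_in)
    ultimately have "f = id" by (auto simp: fun_eq_iff)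
    then show False using f(2) by simp
  qed
  then show "{x \<in> carrier G. f x = x} \<subset> carrier G" by blast
qed

text \<open>Invariance of \<open>S - H\<close> under multiplication by an element \<open>k\<close>
  of \<open>H\<close> is thereby expressed as invariance of \<open>S\<close> under a single
  permutation.\<close>

definition coset_twist :: "'a set \<Rightarrow> 'a \<Rightarrow> 'a \<Rightarrow> 'a" where
  "coset_twist H k = (\<lambda>x. if x \<in> carrier G - H then k \<otimes> x else x)"

lemma coset_twist:
  assumes fin: "finite (carrier G)" and H: "subgroup H G" "H \<noteq> carrier G" and k: "k \<in> H" "k \<noteq> \<one>"
  shows "coset_twist H k permutes carrier G"
    and "2 * card {x \<in> carrier G. coset_twist H k x = x} \<le> card (carrier G)"
proof -
  have Hc: "H \<subseteq> carrier G"
    using H(1) by (rule subgroup.subset)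
  then have kc: "k \<in> carrier G"
    using k(1) by blast
  have out: "h \<otimes> x \<notin> H" if "h \<in> H" "x \<in> carrier G" "x \<notin> H" for h x
  proof
    assume "h \<otimes> x \<in> H"
    then have "inv h \<otimes> (h \<otimes> x) \<in> H"
      using that(1) H(1) by (simp add: subgroup.m_closed subgroup.m_inv_closed)
    moreover have "h \<in> carrier G"
      using that(1) Hc by blast
    ultimately show False
      using that by (simp flip: m_assoc)
  qed
  have ik: "inv k \<in> H"
    using H(1) k(1) by (simp add: subgroup.m_inv_closed)
  show "coset_twist H k permutes carrier G"
  proof (rule bij_imp_permutes)
    show "bij_betw (coset_twist H k) (carrier G) (carrier G)"
      by (rule bij_betw_byWitness[of _ "coset_twist H (inv k)"])
        (use kc out[OF k(1)] out[OF ik] in \<open>auto simp: coset_twist_def simp flip: m_assoc\<close>)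
  qed (simp add: coset_twist_def)
  have "{x \<in> carrier G. coset_twist H k x = x} = H"
  proof -
    have "k \<otimes> x \<noteq> x" if "x \<in> carrier G" for x
      using that kc k(2) by simp
    then show ?thesis
      using Hc by (auto simp: coset_twist_def)
  qed
  then show "2 * card {x \<in> carrier G. coset_twist H k x = x} \<le> card (carrier G)"
    using card_proper_subgroup_le[OF H(1) subgroup_self _ fin] Hc H(2) by auto
qed

text \<open>The digraph automorphisms again, but extended by the identity off the carrier, to be
  comparable with \<open>shifts\<close> and closed under plain composition.\<close>

definition cayley_perms :: "'a set \<Rightarrow> ('a \<Rightarrow> 'a) set" where
  "cayley_perms S = {f. f permutes carrier G \<and>
     (\<forall>x\<in>carrier G. \<forall>y\<in>carrier G. (x, y) \<in> cayley_arcs G S \<longleftrightarrow> (f x, f y) \<in> cayley_arcs G S)}"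

lemma cayley_perms_comp:
  assumes f: "f \<in> cayley_perms S" and g: "g \<in> cayley_perms S"
  shows "f \<circ> g \<in> cayley_perms S"
proof -
  have p: "f permutes carrier G" "g permutes carrier G"
    using f g by (simp_all add: cayley_perms_def)
  then have "f \<circ> g permutes carrier G"
    by (intro permutes_compose)
  moreover have "g x \<in> carrier G" if "x \<in> carrier G" for x
    using that by (simp add: permutes_in_image[OF p(2)])
  ultimately show ?thesis
    using f g by (simp add: cayley_perms_def)
qed

lemma shifts_subset_cayley_perms: "shifts \<subseteq> cayley_perms S"
proof
  fix f assume "f \<in> shifts"
  then obtain a where a: "a \<in> carrier G" "f = shift a"
    by (auto simp: shifts_def)
  have "x \<otimes> a \<otimes> inv (y \<otimes> a) = x \<otimes> inv y" if "x \<in> carrier G" "y \<in> carrier G" for x y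
  proof -
    have "x \<otimes> a \<otimes> inv (y \<otimes> a) = x \<otimes> (a \<otimes> inv a) \<otimes> inv y"
      using that a(1) by (simp only: inv_mult_group m_assoc m_closed inv_closed)
    then show ?thesis
      using that a(1) by simp
  qed
  then show "f \<in> cayley_perms S"
    using a shift_permutes[OF a(1)] by (simp add: cayley_perms_def cayley_arcs_def)
qed

text \<open>Membership of \<open>x\<close> in \<open>S\<close> means that \<open>x\<close> has an
  arc to \<open>\<one>\<close>.\<close>

lemma cayley_perms_stab_invariant:
  assumes "f \<in> cayley_perms S" "f \<one> = \<one>" "x \<in> carrier G"
  shows "x \<in> S \<longleftrightarrow> f x \<in> S"
proof -
  have "f x \<in> carrier G"
    using assms by (simp add: cayley_perms_def permutes_in_image)
  moreover have "(x, \<one>) \<in> cayley_arcs G S \<longleftrightarrow> (f x, \<one>) \<in> cayley_arcs G S"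
    using assms by (force simp: cayley_perms_def)
  ultimately show ?thesis
    using assms(3) by (simp add: cayley_arcs_def)
qed

lemma is_DRR_if_cayley_perms_subset:
  assumes "cayley_perms S \<subseteq> shifts"
  shows "is_DRR G S"
  unfolding is_DRR_def
proof (intro equalityI subsetI)
  fix f assume f: "f \<in> digraph_aut (carrier G) (cayley_arcs G S)"
  \<comment> \<open>An extensional \<open>f\<close> is \<open>undefined\<close> off the carrier;
    \<open>g\<close> has the identity there instead.\<close>
  define g where "g x = (if x \<in> carrier G then f x else x)" for x
  have "bij_betw g (carrier G) (carrier G)"
    using f bij_betw_cong[of "carrier G" f g] by (simp add: digraph_aut_def g_def)
  then have "g permutes carrier G"
    by (rule bij_imp_permutes) (simp add: g_def)
  then have "g \<in> cayley_perms S"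
    using f by (simp add: cayley_perms_def digraph_aut_def g_def)
  then obtain a where a: "a \<in> carrier G" "g = shift a"
    using assms by (auto simp: shifts_def)
  have "f x = (\<lambda>x\<in>carrier G. x \<otimes> a) x" for x
  proof (cases "x \<in> carrier G")
    case True
    then show ?thesis
      using fun_cong[OF a(2), of x] by (simp add: g_def)
  next
    case False
    then show ?thesis
      using f by (simp add: digraph_aut_def extensional_def)
  qed
  then show "f \<in> right_regular G"
    using a(1) unfolding right_regular_def by blast
next
  fix f assume "f \<in> right_regular G"
  then obtain a where a: "a \<in> carrier G" "f = (\<lambda>x\<in>carrier G. x \<otimes> a)"
    by (auto simp: right_regular_def)
  have s: "shift a \<in> cayley_perms S"
    using shifts_subset_cayley_perms a(1) by (auto simp: shifts_def)
  then have "bij_betw (shift a) (carrier G) (carrier G)"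
    by (simp add: cayley_perms_def permutes_imp_bij)
  then have "bij_betw f (carrier G) (carrier G)"
    using bij_betw_cong[of "carrier G" f "shift a"] a(2) by simp
  then show "f \<in> digraph_aut (carrier G) (cayley_arcs G S)"
    using s a(2) by (simp add: digraph_aut_def cayley_perms_def)
qed

end

section \<open>Invariance of the exceptional sets and the union bound\<close>

context comm_group
begin

text \<open>A permutation that normalises the regular subgroup becomes a group automorphism once it
  is corrected by a shift to fix \<open>\<one>\<close>. The intertwining element \<open>b\<close>
  for \<open>y\<close> is then the image of \<open>y\<close>.\<close>

lemma normalising_cayley_perm:
  assumes g: "g \<in> cayley_perms S" "g \<notin> shifts"
    and norm: "\<And>a. a \<in> carrier G \<Longrightarrow> \<exists>b\<in>carrier G. \<forall>x\<in>carrier G. g (x \<otimes> a) = g x \<otimes> b"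
  shows "\<exists>f\<in>perm_autos - {id}. \<forall>x\<in>carrier G. x \<in> S \<longleftrightarrow> f x \<in> S"
proof
  have gp: "g permutes carrier G"
    using g(1) by (simp add: cayley_perms_def)
  have gc: "g x \<in> carrier G" if "x \<in> carrier G" for x
    using gp that by (simp add: permutes_in_image)
  let ?f = "shift (inv (g \<one>)) \<circ> g"
  have f: "?f x = g x \<otimes> inv (g \<one>)" if "x \<in> carrier G" for x
    using gc that by simp
  have "shift (inv (g \<one>)) \<in> shifts"
    using gc by (simp add: shifts_def)
  then have fS: "?f \<in> cayley_perms S"
    using shifts_subset_cayley_perms g(1) by (blast intro: cayley_perms_comp)
  have "?f \<one> = \<one>"
    using gc by simp
  then show "\<forall>x\<in>carrier G. x \<in> S \<longleftrightarrow> ?f x \<in> S"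
    using cayley_perms_stab_invariant[OF fS] by blast
  have "?f \<in> hom G G"
  proof (rule homI)
    fix x y assume xy: "x \<in> carrier G" "y \<in> carrier G"
    obtain b where b: "b \<in> carrier G" "\<And>x. x \<in> carrier G \<Longrightarrow> g (x \<otimes> y) = g x \<otimes> b"
      using norm[OF xy(2)] by blast
    have "g y = g \<one> \<otimes> b"
      using b(2)[of \<one>] xy by simp
    then have "?f y = b"
      using gc[of \<one>] xy b(1) by (simp add: f m_comm[of _ b] m_assoc)
    moreover have "?f (x \<otimes> y) = ?f x \<otimes> b"
      using gc[of \<one>] gc[of x] xy b by (simp add: m_assoc m_comm[of b])
    ultimately show "?f (x \<otimes> y) = ?f x \<otimes> ?f y"
      by simp
  qed (use gc in simp)
  moreover have "?f \<noteq> id"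
  proof
    assume "?f = id"
    then have e: "g x \<otimes> inv (g \<one>) = x" if "x \<in> carrier G" for x
      using f[OF that] by simp
    have "g x = shift (g \<one>) x" for x
    proof (cases "x \<in> carrier G")
      case True
      have "g x = g x \<otimes> inv (g \<one>) \<otimes> g \<one>"
        using gc[OF True] gc[of \<one>] by (simp add: m_assoc)
      then show ?thesis
        unfolding e[OF True] using True by simp
    next
      case False
      then show ?thesis
        using gp by (simp add: shift_def permutes_not_in)
    qed
    then have "g = shift (g \<one>)" by blast
    then show False
      using g(2) gc[of \<one>] by (auto simp: shifts_def)
  qed
  ultimately show "?f \<in> perm_autos - {id}"
    using fS by (simp add: perm_autos_def cayley_perms_def)
qed

lemma not_DRR_invariant:
  assumes fin: "finite (carrier G)" and S: "\<not> is_DRR G S"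
  shows "(\<exists>f\<in>perm_autos - {id}. \<forall>x\<in>carrier G. x \<in> S \<longleftrightarrow> f x \<in> S) \<or>
    (\<exists>H k. subgroup H G \<and> H \<noteq> carrier G \<and> k \<in> H \<and> k \<noteq> \<one> \<and>
       (\<forall>x\<in>carrier G. x \<in> S \<longleftrightarrow> coset_twist H k x \<in> S))"
proof -
  define overgroup where "overgroup U \<longleftrightarrow> shifts \<subseteq> U \<and> U \<subseteq> cayley_perms S \<and> U \<noteq> shifts \<and>
    (\<forall>g\<in>U. \<forall>h\<in>U. g \<circ> h \<in> U)" for U
  have "overgroup (cayley_perms S)"
    using is_DRR_if_cayley_perms_subset[of S] S shifts_subset_cayley_perms[of S]
    by (auto simp: overgroup_def cayley_perms_comp)
  then obtain U where U: "overgroup U" and least: "\<And>C. overgroup C \<Longrightarrow> card U \<le> card C"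
    using ex_has_least_nat[of overgroup _ card] by blast
  have US: "g \<in> cayley_perms S" if "g \<in> U" for g
    using that U by (auto simp: overgroup_def)
  have "finite U"
    by (rule finite_subset[OF _ finite_permutations[OF fin]])
      (use US in \<open>auto simp: cayley_perms_def\<close>)
  show ?thesis
  \<comment> \<open>The cases ask whether \<open>shifts\<close> differs from its normaliser in
    \<open>U\<close>.\<close>
  proof (cases "\<exists>g\<in>U - shifts. \<forall>a\<in>carrier G. \<exists>b\<in>carrier G. \<forall>x\<in>carrier G. g (x \<otimes> a) = g x \<otimes> b")
    case True
    then obtain g where "g \<in> U" "g \<notin> shifts"
      "\<forall>a\<in>carrier G. \<exists>b\<in>carrier G. \<forall>x\<in>carrier G. g (x \<otimes> a) = g x \<otimes> b" by blast
    then show ?thesis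
      using normalising_cayley_perm[OF US] by blast
  next
    case False
    interpret minimal_overgroup G U
    proof unfold_locales
      show "finite (carrier G)" by (fact fin)
      show "g permutes carrier G" if "g \<in> U" for g
        using US[OF that] by (simp add: cayley_perms_def)
      show "g \<circ> h \<in> U" if "g \<in> U" "h \<in> U" for g h
        using that U by (simp add: overgroup_def)
      show "shifts \<subseteq> U" "U \<noteq> shifts"
        using U by (simp_all add: overgroup_def)
      show "C = shifts \<or> C = U"
        if C: "shifts \<subseteq> C" "C \<subseteq> U" "\<And>g h. g \<in> C \<Longrightarrow> h \<in> C \<Longrightarrow> g \<circ> h \<in> C" for C
      proof (rule disjCI)
        assume "C \<noteq> U"
        then have "card C < card U"
          using C(2) \<open>finite U\<close> by (intro psubset_card_mono) auto
        then have "\<not> overgroup C"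
          using least by force
        then show "C = shifts"
          using C US by (auto simp: overgroup_def)
      qed
      show "g \<in> shifts"
        if "g \<in> U" "\<And>a. a \<in> carrier G \<Longrightarrow> \<exists>b\<in>carrier G. \<forall>x\<in>carrier G. g (x \<otimes> a) = g x \<otimes> b" for g
        using False that by blast
    qed
    obtain H k where H: "subgroup H G" "H \<noteq> carrier G" "k \<in> H" "k \<noteq> \<one>"
      and t: "\<forall>x\<in>carrier G - H. \<exists>t\<in>U. t \<one> = \<one> \<and> t x = k \<otimes> x"
      by (rule coset_structure)
    have "x \<in> S \<longleftrightarrow> coset_twist H k x \<in> S" if x: "x \<in> carrier G" for x
    proof (cases "x \<in> H")
      case False
      then obtain t where "t \<in> U" "t \<one> = \<one>" "t x = k \<otimes> x"
        using t x by blast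
      then show ?thesis
        using cayley_perms_stab_invariant[OF US _ x, of t] x False by (simp add: coset_twist_def)
    qed (simp add: coset_twist_def)
    then show ?thesis
      using H by blast
  qed
qed

text \<open>Union bound: at most \<open>n ^ d\<close> automorphisms and \<open>n * n ^ d\<close>
  twists occur, and each suitable one preserves few sets.\<close>

lemma card_not_DRR_le:
  assumes fin: "finite (carrier G)" and d: "card (carrier G) < 2 ^ Suc d"
  defines "n \<equiv> card (carrier G)"
  shows "real (card {S. S \<subseteq> carrier G \<and> \<not> is_DRR G S})
    \<le> real ((1 + n) * n ^ d) * 2 powr (3 * real n / 4)"
proof -
  define I where "I p = {S. S \<subseteq> carrier G \<and> (\<forall>x\<in>carrier G. x \<in> S \<longleftrightarrow> p x \<in> S)}" for p
  define T where "T = (\<lambda>(k, H). coset_twist H k) ` (carrier G \<times> {H. subgroup H G})"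
  \<comment> \<open>\<open>T\<close> contains twists for all pairs, even with \<open>k\<close>
    outside \<open>H\<close>; \<open>P\<close> retains the maps to which
    \<open>card_invariant_subsets_le\<close> applies.\<close>
  define P where "P = {p \<in> perm_autos \<union> T. p permutes carrier G \<and>
    2 * card {x \<in> carrier G. p x = x} \<le> card (carrier G)}"
  have finH: "finite {H. subgroup H G}"
    by (rule finite_subset[of _ "Pow (carrier G)"]) (auto simp: fin dest: subgroup.subset)
  have "card T \<le> card (carrier G \<times> {H. subgroup H G})"
    unfolding T_def by (rule card_image_le) (simp add: fin finH)
  also have "\<dots> \<le> n * n ^ d"
    using card_subgroups_le[OF fin d] by (simp add: card_cartesian_product n_def)
  finally have cT: "card T \<le> n * n ^ d" .
  have fU: "finite (perm_autos \<union> T)"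
    using finite_subset[OF _ finite_permutations[OF fin], of perm_autos]
    by (auto simp: perm_autos_def T_def fin finH)
  have "card P \<le> card (perm_autos \<union> T)"
    using fU by (rule card_mono) (auto simp: P_def)
  also have "\<dots> \<le> card perm_autos + card T"
    by (rule card_Un_le)
  also have "\<dots> \<le> (1 + n) * n ^ d"
    using cT card_perm_autos_le[OF fin d] by (simp add: n_def)
  finally have cP: "card P \<le> (1 + n) * n ^ d" .
  have fP: "finite P"
    using fU by (rule rev_finite_subset) (auto simp: P_def)
  have "{S. S \<subseteq> carrier G \<and> \<not> is_DRR G S} \<subseteq> (\<Union>p\<in>P. I p)"
  proof
    fix S assume "S \<in> {S. S \<subseteq> carrier G \<and> \<not> is_DRR G S}"
    then have S: "S \<subseteq> carrier G" "\<not> is_DRR G S" by auto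
    from not_DRR_invariant[OF fin S(2)] have "\<exists>p\<in>P. \<forall>x\<in>carrier G. x \<in> S \<longleftrightarrow> p x \<in> S"
    proof (elim disjE bexE exE conjE)
      fix f assume f: "f \<in> perm_autos - {id}" "\<forall>x\<in>carrier G. x \<in> S \<longleftrightarrow> f x \<in> S"
      then have "f \<in> P"
        using perm_auto_few_fixed[OF fin, of f] by (simp add: P_def perm_autos_def)
      then show ?thesis using f(2) by blast
    next
      fix H k assume H: "subgroup H G" "H \<noteq> carrier G" "k \<in> H" "k \<noteq> \<one>"
        and inv: "\<forall>x\<in>carrier G. x \<in> S \<longleftrightarrow> coset_twist H k x \<in> S"
      have "k \<in> carrier G"
        using subgroup.subset[OF H(1)] H(3) by blast
      then have "coset_twist H k \<in> T"
        using H(1) by (force simp: T_def)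
      then have "coset_twist H k \<in> P"
        using coset_twist[OF fin H] by (simp add: P_def)
      then show ?thesis using inv by blast
    qed
    then show "S \<in> (\<Union>p\<in>P. I p)"
      using S(1) by (auto simp: I_def)
  qed
  moreover have "finite (\<Union>p\<in>P. I p)"
    using fP fin by (auto simp: I_def)
  ultimately have "card {S. S \<subseteq> carrier G \<and> \<not> is_DRR G S} \<le> card (\<Union>p\<in>P. I p)"
    by (simp add: card_mono)
  also have "\<dots> \<le> (\<Sum>p\<in>P. card (I p))"
    using fP by (rule card_UN_le)
  finally have "real (card {S. S \<subseteq> carrier G \<and> \<not> is_DRR G S}) \<le> (\<Sum>p\<in>P. real (card (I p)))"
    by (simp flip: of_nat_sum)
  also have "\<dots> \<le> real (card P) * 2 powr (3 * real n / 4)"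
  proof (rule sum_bounded_above)
    fix p assume "p \<in> P"
    then show "real (card (I p)) \<le> 2 powr (3 * real n / 4)"
      unfolding I_def n_def by (intro card_invariant_subsets_le fin) (auto simp: P_def)
  qed
  also have "\<dots> \<le> real ((1 + n) * n ^ d) * 2 powr (3 * real n / 4)"
    using cP by (intro mult_right_mono) (simp_all only: of_nat_le_iff powr_ge_zero)
  finally show ?thesis .
qed

end

theorem theorem1p4:
  fixes A :: "('a, 'b) monoid_scheme"
  assumes "comm_group A" and "finite (carrier A)"
  shows "real (card {S. S \<subseteq> carrier A \<and> \<not> is_DRR A S})
           \<le> 2 powr (3 * real (card (carrier A)) / 4 + 2 * (log 2 (real (card (carrier A))))\<^sup>2 + 1)"
proof -
  interpret comm_group A by (fact assms(1))
  define n where "n = card (carrier A)"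
  define L where "L = log 2 (real n)"
  let ?B = "{S. S \<subseteq> carrier A \<and> \<not> is_DRR A S}"
  have "n \<ge> 1"
    using assms(2) one_closed card_gt_0_iff[of "carrier A"] by (auto simp: n_def Suc_le_eq)
  have "real (card ?B) \<le> 2 powr (3 * real n / 4 + 2 * L\<^sup>2 + 1)"
  \<comment> \<open>For \<open>n = 1\<close> the logarithm vanishes and the two subsets are covered
    by the summand 1 in the exponent; otherwise \<open>L \<ge> 1\<close>.\<close>
  proof (cases "n = 1")
    case True
    have "card ?B \<le> card (Pow (carrier A))"
      using assms(2) by (intro card_mono) auto
    then have "real (card ?B) \<le> 2 powr 1"
      using True assms(2) by (simp add: card_Pow n_def)
    also have "\<dots> \<le> 2 powr (3 * real n / 4 + 2 * L\<^sup>2 + 1)"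
      by (intro powr_mono) simp_all
    finally show ?thesis .
  next
    case False
    then have n2: "real n \<ge> 2"
      using \<open>n \<ge> 1\<close> by simp
    then have L1: "L \<ge> 1"
      by (simp add: L_def le_log_iff)
    have nL: "real n = 2 powr L"
      using n2 by (simp add: L_def)
    obtain d where d: "2 ^ d \<le> n" "n < 2 ^ (d + 1)"
      using ex_power_ivl1[of 2 n] \<open>n \<ge> 1\<close> by auto
    have "2 powr real d \<le> real n"
      using d(1) by (simp add: powr_realpow flip: of_nat_le_iff)
    then have dL: "real d \<le> L"
      using n2 by (simp add: L_def le_log_iff)
    \<comment> \<open>\<open>1 + n\<close> is at most \<open>2 * n\<close>, and
      \<open>d \<le> L\<close> with \<open>L \<ge> 1\<close> bounds the resulting exponent
      \<open>1 + L + L * d\<close> by \<open>2 * L * L + 1\<close>.\<close>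
    have "real ((1 + n) * n ^ d) \<le> 2 * real n * real n ^ d"
      using n2 by (simp add: mult_right_mono)
    also have "\<dots> = 2 powr (1 + L + L * real d)"
      using n2 by (simp add: nL powr_add powr_powr flip: powr_realpow)
    also have "\<dots> \<le> 2 powr (2 * L\<^sup>2 + 1)"
    proof (rule powr_mono)
      have "L * real d \<le> L * L" "L * 1 \<le> L * L"
        using dL L1 by (intro mult_left_mono; simp)+
      then show "1 + L + L * real d \<le> 2 * L\<^sup>2 + 1"
        by (simp add: power2_eq_square)
    qed simp
    finally have c: "real ((1 + n) * n ^ d) \<le> 2 powr (2 * L\<^sup>2 + 1)" .
    have "real (card ?B) \<le> real ((1 + n) * n ^ d) * 2 powr (3 * real n / 4)"
      using card_not_DRR_le[OF assms(2), of d] d(2) by (simp add: n_def)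
    also have "\<dots> \<le> 2 powr (2 * L\<^sup>2 + 1) * 2 powr (3 * real n / 4)"
      using c by (rule mult_right_mono) simp
    also have "\<dots> = 2 powr (3 * real n / 4 + 2 * L\<^sup>2 + 1)"
      by (simp add: add_ac flip: powr_add)
    finally show ?thesis .
  qed
  then show ?thesis by (simp only: n_def L_def)
qed


end
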